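(* Consider the plant $$ \left\{ \begin{array}{rcl} \mathbf{x}_{k+1} & = & A \mathbf{x}_{k},\\ \mathbf{y}_{k} & = & C \mathbf{x}_{k} +\mathbf{v}_k, \end{array} \right. $$ with ARMA measurement noise $\mathbf{v}_{k} = \sum_{i=1}^{p} f_{i} \mathbf{v}_{k-i} + \widehat{\mathbf{v}}_k + \sum_{j=1}^{q} g_{j} \widehat{\mathbf{v}}_{k-j}$. Denote $$ \widehat{\mathbf{y}}_{k} = - \sum_{j=1}^{q} g_{j} \widehat{\mathbf{y}}_{k-j} + \mathbf{y}_{k} - \sum_{i=1}^{p} f_{i} \mathbf{y}_{k-i}. $$ Then the plant is equivalent to $$ \left\{ \begin{array}{rcl} \mathbf{x}_{k+1} & = & A \mathbf{x}_{k},\\ \widehat{\mathbf{y}}_{k} & = & \widehat{C} \mathbf{x}_{k} + \widehat{\mathbf{v}}_k, \end{array} \right. $$ where $$ \widehat{C} = C \left( I - \sum_{i=1}^{p} f_{i} A^{-i} \right) \left( I + \sum_{j=1}^{q} g_{j} A^{-j} \right)^{-1}. $$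
   Context: $\mathbf{x}_k\in\mathbb{R}^n$, $\mathbf{y}_k,\mathbf{v}_k,\widehat{\mathbf{v}}_k\in\mathbb{R}$ are zero-mean random quantities; $A\in\mathbb{R}^{n\times n}$ is anti-stable (all eigenvalues have magnitude greater than or equal to $1$, so $A$ is invertible), $C\in\mathbb{R}^{1\times n}$, and $(A,C)$ is observable. $\{\widehat{\mathbf{v}}_k\}$ is white Gaussian with variance $\sigma_{\widehat{\mathbf{v}}}^2>0$, and $f_i,g_j\in\mathbb{R}$. The filter $F(z)=\dfrac{1+\sum_{j=1}^q g_jz^{-j}}{1-\sum_{i=1}^p f_iz^{-i}}$, whose output when driven by $\{\widehat{\mathbf{v}}_k\}$ is $\{\mathbf{v}_k\}$, is assumed stable and minimum-phase (all poles and zeros strictly inside the unit circle). The processes are considered with infinite past: $\mathbf{x}_{k-i}=A^{-i}\mathbf{x}_k$ for all $i\ge0$, and $\{\widehat{\mathbf{y}}_k\}$ is the output of the stable causal inverse filter $F^{-1}(z)=\frac{1-\sum_{i=1}^p f_iz^{-i}}{1+\sum_{j=1}^q g_jz^{-j}}$ driven by $\{\mathbf{y}_k\}$. "Equivalent" means that, with the same state process $\{\mathbf{x}_k\}$ and with $\{\widehat{\mathbf{y}}_k\}$ obtained from $\{\mathbf{y}_k\}$ by this (invertible) filtering, the output equation $\mathbf{y}_k=C\mathbf{x}_k+\mathbf{v}_k$ is the same as the output equation $\widehat{\mathbf{y}}_k=\widehat{C}\mathbf{x}_k+\widehat{\mathbf{v}}_k$. *)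

theory Defs
  imports "HOL-Probability.Probability" "HOL-Computational_Algebra.Formal_Power_Series"
begin

unbundle no fps_syntax

text \<open>
  Processes are two-sided (indexed by \<open>int\<close>), and equations between random variables
  hold almost surely.  Coefficient sequences \<open>f\<close>, \<open>g\<close> are read only at the
  indices \<open>1..p\<close> and \<open>1..q\<close>.
\<close>

primrec matrix_power :: "real ^ 'n ^ 'n \<Rightarrow> nat \<Rightarrow> real ^ 'n ^ 'n" where
  "matrix_power A 0 = mat 1"
| "matrix_power A (Suc i) = A ** matrix_power A i"

definition is_eigenvalue :: "real ^ 'n ^ 'n \<Rightarrow> complex \<Rightarrow> bool" where
  "is_eigenvalue A c \<longleftrightarrow> (\<exists>w. w \<noteq> 0 \<and> map_matrix complex_of_real A *v w = c *s w)"

definition anti_stable :: "real ^ 'n ^ 'n \<Rightarrow> bool" where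
  "anti_stable A \<longleftrightarrow> (\<forall>c. is_eigenvalue A c \<longrightarrow> 1 \<le> norm c)"

text \<open>The observability matrix, whose rows are those of \<open>C\<close>, \<open>C A\<close>, \dots,
  \<open>C A\<^sup>n\<^sup>-\<^sup>1\<close>, has full rank \<open>n\<close>.\<close>

definition observable :: "real ^ 'n ^ 'n \<Rightarrow> real ^ 'n ^ 'm \<Rightarrow> bool" where
  "observable A C \<longleftrightarrow> dim (\<Union>i<CARD('n). rows (C ** matrix_power A i)) = CARD('n)"

definition zero_mean :: "'a measure \<Rightarrow> (int \<Rightarrow> 'a \<Rightarrow> 'b::euclidean_space) \<Rightarrow> bool" where
  "zero_mean M X \<longleftrightarrow> (\<forall>k. integrable M (X k) \<and> integral\<^sup>L M (X k) = 0)"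

definition white_gaussian :: "'a measure \<Rightarrow> real \<Rightarrow> (int \<Rightarrow> 'a \<Rightarrow> real) \<Rightarrow> bool" where
  "white_gaussian M \<sigma> u \<longleftrightarrow>
     prob_space.indep_vars M (\<lambda>_. borel) u UNIV \<and>
     (\<forall>k. distributed M lborel (u k) (normal_density 0 \<sigma>))"

text \<open>The rational transfer function \<open>F(z)\<close> with numerator \<open>1 + \<Sum> g\<^sub>j z\<^sup>-\<^sup>j\<close>
  and denominator \<open>1 - \<Sum> f\<^sub>i z\<^sup>-\<^sup>i\<close>, expanded at \<open>z = \<infinity>\<close>: the
  formal variable \<open>fps_X\<close> is the delay \<open>z\<^sup>-\<^sup>1\<close>, so the coefficients are the causal impulse
  response.  The constant coefficient is \<open>1\<close>, hence \<open>inverse\<close> is \<open>F\<^sup>-\<^sup>1(z)\<close>.\<close>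

definition arma_filter :: "nat \<Rightarrow> (nat \<Rightarrow> real) \<Rightarrow> nat \<Rightarrow> (nat \<Rightarrow> real) \<Rightarrow> real fps" where
  "arma_filter p f q g =
     (1 + (\<Sum>j=1..q. fps_const (g j) * fps_X ^ j)) / (1 - (\<Sum>i=1..p. fps_const (f i) * fps_X ^ i))"

text \<open>Poles and zeros are the roots of the denominator and of the numerator of \<open>F(z)\<close> as
  written, without cancellation of common factors.  A root at the origin satisfies the bound
  anyway; in the formulas below \<open>z = 0\<close> never qualifies as a root since \<open>a / 0 = 0\<close>.\<close>

definition stable_filter :: "nat \<Rightarrow> (nat \<Rightarrow> real) \<Rightarrow> bool" where
  "stable_filter p f \<longleftrightarrow>
     (\<forall>z::complex. 1 - (\<Sum>i=1..p. complex_of_real (f i) / z ^ i) = 0 \<longrightarrow> norm z < 1)"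

definition minimum_phase :: "nat \<Rightarrow> (nat \<Rightarrow> real) \<Rightarrow> bool" where
  "minimum_phase q g \<longleftrightarrow>
     (\<forall>z::complex. 1 + (\<Sum>j=1..q. complex_of_real (g j) / z ^ j) = 0 \<longrightarrow> norm z < 1)"

definition filter_output ::
  "'a measure \<Rightarrow> real fps \<Rightarrow> (int \<Rightarrow> 'a \<Rightarrow> real) \<Rightarrow> (int \<Rightarrow> 'a \<Rightarrow> real) \<Rightarrow> bool" where
  "filter_output M H u w \<longleftrightarrow>
     (\<forall>k. AE \<omega> in M. (\<lambda>m. fps_nth H m * u (k - int m) \<omega>) sums w k \<omega>)"

text \<open>The recursions alone determine their solution only up to transients of the homogeneous
  recursion; demanding the filter output as well selects the causal stable solution.\<close>

definition arma_noise ::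
  "'a measure \<Rightarrow> nat \<Rightarrow> (nat \<Rightarrow> real) \<Rightarrow> nat \<Rightarrow> (nat \<Rightarrow> real) \<Rightarrow>
     (int \<Rightarrow> 'a \<Rightarrow> real) \<Rightarrow> (int \<Rightarrow> 'a \<Rightarrow> real) \<Rightarrow> bool" where
  "arma_noise M p f q g vhat v \<longleftrightarrow>
     (\<forall>k. AE \<omega> in M. v k \<omega> =
        (\<Sum>i=1..p. f i * v (k - int i) \<omega>) + vhat k \<omega> + (\<Sum>j=1..q. g j * vhat (k - int j) \<omega>)) \<and>
     filter_output M (arma_filter p f q g) vhat v"

definition inverse_filtered ::
  "'a measure \<Rightarrow> nat \<Rightarrow> (nat \<Rightarrow> real) \<Rightarrow> nat \<Rightarrow> (nat \<Rightarrow> real) \<Rightarrow>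
     (int \<Rightarrow> 'a \<Rightarrow> real) \<Rightarrow> (int \<Rightarrow> 'a \<Rightarrow> real) \<Rightarrow> bool" where
  "inverse_filtered M p f q g y yhat \<longleftrightarrow>
     (\<forall>k. AE \<omega> in M. yhat k \<omega> =
        - (\<Sum>j=1..q. g j * yhat (k - int j) \<omega>) + y k \<omega> - (\<Sum>i=1..p. f i * y (k - int i) \<omega>)) \<and>
     filter_output M (inverse (arma_filter p f q g)) y yhat"

definition plant ::
  "'a measure \<Rightarrow> real ^ 'n ^ 'n \<Rightarrow> real ^ 'n ^ 1 \<Rightarrow>
     (int \<Rightarrow> 'a \<Rightarrow> real ^ 'n) \<Rightarrow> (int \<Rightarrow> 'a \<Rightarrow> real) \<Rightarrow> (int \<Rightarrow> 'a \<Rightarrow> real) \<Rightarrow> bool" where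
  "plant M A C x v y \<longleftrightarrow>
     (\<forall>k. AE \<omega> in M. x (k + 1) \<omega> = A *v x k \<omega>) \<and>
     (\<forall>k. AE \<omega> in M. y k \<omega> = (C *v x k \<omega>) $ 1 + v k \<omega>)"

definition ma_matrix :: "real ^ 'n ^ 'n \<Rightarrow> nat \<Rightarrow> (nat \<Rightarrow> real) \<Rightarrow> real ^ 'n ^ 'n" where
  "ma_matrix A q g = mat 1 + (\<Sum>j=1..q. g j *\<^sub>R matrix_power (matrix_inv A) j)"

definition ar_matrix :: "real ^ 'n ^ 'n \<Rightarrow> nat \<Rightarrow> (nat \<Rightarrow> real) \<Rightarrow> real ^ 'n ^ 'n" where
  "ar_matrix A p f = mat 1 - (\<Sum>i=1..p. f i *\<^sub>R matrix_power (matrix_inv A) i)"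

definition whitened_output_matrix ::
  "real ^ 'n ^ 'n \<Rightarrow> real ^ 'n ^ 1 \<Rightarrow> nat \<Rightarrow> (nat \<Rightarrow> real) \<Rightarrow> nat \<Rightarrow> (nat \<Rightarrow> real) \<Rightarrow>
     real ^ 'n ^ 1" where
  "whitened_output_matrix A C p f q g = C ** ar_matrix A p f ** matrix_inv (ma_matrix A q g)"

end

theory Submission
  imports Defs "HOL-Computational_Algebra.Fundamental_Theorem_Algebra"
begin

text \<open>
  Along a sample path, \<open>C x\<^sub>k + v\<^sub>k\<close> and \<open>Chat x\<^sub>k + vhat\<^sub>k\<close> satisfy the filter recursion, because
  \<open>x\<^sub>k\<^sub>-\<^sub>i\<close> is the \<open>i\<close>-th power of the inverse of \<open>A\<close> applied to \<open>x\<^sub>k\<close>.  The recursion determines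
  the output of the causal filter as soon as both sequences grow, towards the past, more slowly than
  the impulse response decays.  The impulse response decays geometrically since the roots lie
  strictly inside the unit circle; the backward orbit of an anti-stable \<open>A\<close> grows more slowly than
  every \<open>s\<^sup>m\<close> with \<open>s > 1\<close>; and so does almost every path of the white noise, because
  \<open>\<Sum> s\<^sup>-\<^sup>m \<bar>vhat\<^sub>k\<^sub>-\<^sub>m\<bar>\<close> has finite expectation.
\<close>

subsection \<open>Linear recurrences\<close>

text \<open>The polynomial \<open>p\<close> in the shift operator, applied to \<open>a\<close>.
  Where it vanishes for all \<open>m\<close>, \<open>a\<close> solves the linear recurrence with
  characteristic polynomial \<open>p\<close>.\<close>

definition shift_poly :: "'a::comm_ring_1 poly \<Rightarrow> (nat \<Rightarrow> 'a) \<Rightarrow> nat \<Rightarrow> 'a" where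
  "shift_poly p a m = (\<Sum>i\<le>degree p. coeff p i * a (m + i))"

lemma shift_poly_eq_sum:
  assumes "degree p \<le> n"
  shows "shift_poly p a m = (\<Sum>i\<le>n. coeff p i * a (m + i))"
  unfolding shift_poly_def
  by (rule sum.mono_neutral_left) (use assms in \<open>auto simp: coeff_eq_0\<close>)

lemma shift_poly_const [simp]: "shift_poly [:c:] a m = c * a m"
  by (simp add: shift_poly_def)

lemma shift_poly_add: "shift_poly (p + q) a m = shift_poly p a m + shift_poly q a m"
proof -
  define n where "n = max (degree p) (degree q)"
  have "degree (p + q) \<le> n" "degree p \<le> n" "degree q \<le> n"
    by (auto simp: n_def intro: degree_add_le)
  then show ?thesis
    by (simp add: shift_poly_eq_sum[of _ n] distrib_right sum.distrib)
qed

lemma shift_poly_sum: "shift_poly (\<Sum>i\<in>I. p i) a m = (\<Sum>i\<in>I. shift_poly (p i) a m)"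
proof (induction I rule: infinite_finite_induct)
  case (insert i I)
  then show ?case by (simp add: shift_poly_add)
qed (simp_all add: shift_poly_def)

lemma shift_poly_monom: "shift_poly (monom c i) a m = c * a (m + i)"
proof -
  have "shift_poly (monom c i) a m = (\<Sum>j\<le>i. (if i = j then c else 0) * a (m + j))"
    by (subst shift_poly_eq_sum[of _ i]) (simp_all add: degree_monom_le)
  also have "\<dots> = (\<Sum>j\<le>i. if i = j then c * a (m + j) else 0)"
    by (rule sum.cong) auto
  also have "\<dots> = c * a (m + i)" by (simp add: sum.delta)
  finally show ?thesis .
qed

text \<open>Products of polynomials act as compositions of operators, so a recurrence can be peeled
  one root at a time.\<close>

lemma shift_poly_linear_factor:
  "shift_poly ([:-\<mu>, 1:] * q) a m = shift_poly q (\<lambda>m. a (Suc m) - \<mu> * a m) m"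
proof -
  define n where "n = degree q"
  have eq: "[:-\<mu>, 1:] * q = pCons 0 q + smult (-\<mu>) q"
    by (simp add: mult_pCons_left)
  have "shift_poly (pCons 0 q) a m = (\<Sum>i\<le>Suc n. coeff (pCons 0 q) i * a (m + i))"
    by (rule shift_poly_eq_sum) (simp add: n_def degree_pCons_le)
  also have "\<dots> = (\<Sum>i\<le>n. coeff q i * a (Suc (m + i)))"
    by (simp add: sum.atMost_Suc_shift del: sum.atMost_Suc)
  finally have 1: "shift_poly (pCons 0 q) a m = (\<Sum>i\<le>n. coeff q i * a (Suc (m + i)))" .
  have 2: "shift_poly (smult (-\<mu>) q) a m = (\<Sum>i\<le>n. - \<mu> * coeff q i * a (m + i))"
    by (subst shift_poly_eq_sum[of _ n]) (auto simp: n_def intro: degree_smult_le)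
  show ?thesis
    unfolding eq shift_poly_add 1 2
    by (simp add: shift_poly_def n_def sum.distrib[symmetric] algebra_simps)
qed

lemma poly_complex_induct [consumes 1, case_names const factor]:
  fixes p :: "complex poly"
  assumes "p \<noteq> 0"
    and "\<And>c. c \<noteq> 0 \<Longrightarrow> P [:c:]"
    and "\<And>\<mu> q. q \<noteq> 0 \<Longrightarrow> P q \<Longrightarrow> P ([:-\<mu>, 1:] * q)"
  shows "P p"
  using assms(1)
proof (induction "degree p" arbitrary: p rule: less_induct)
  case less
  show ?case
  proof (cases "degree p = 0")
    case True
    then obtain c where "p = [:c:]" by (rule degree_eq_zeroE)
    with less assms(2) show ?thesis by auto
  next
    case False
    then have "\<not> constant (poly p)" by (simp add: constant_degree)
    then obtain \<mu> where "poly p \<mu> = 0" using fundamental_theorem_of_algebra by blast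
    then obtain q where q: "p = [:-\<mu>, 1:] * q" by (auto simp: poly_eq_0_iff_dvd)
    with less have "q \<noteq> 0" by auto
    then have "degree p = Suc (degree q)" unfolding q by (subst degree_mult_eq) auto
    then show ?thesis using less(1)[of q] assms(3)[of q \<mu>] \<open>q \<noteq> 0\<close> q by auto
  qed
qed

text \<open>Splitting off a root \<open>\<mu>\<close> leaves a first-order recurrence with ratio
  \<open>\<mu>\<close> whose forcing term is of order \<open>s ^ m\<close> by induction. The gap
  between \<open>norm \<mu>\<close> and \<open>s\<close> absorbs the polynomial factors that
  multiple roots produce.\<close>

lemma recurrence_growth:
  fixes p :: "complex poly"
  assumes "p \<noteq> 0" and "\<And>z. poly p z = 0 \<Longrightarrow> norm z < s" and "0 < s"
    and "\<And>m. shift_poly p a m = 0"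
  shows "\<exists>K. \<forall>m. norm (a m) \<le> K * s ^ m"
  using assms(1,2,4)
proof (induction p arbitrary: a rule: poly_complex_induct)
  case (const c)
  then show ?case by (intro exI[of _ 0]) auto
next
  case (factor \<mu> q)
  have \<mu>: "norm \<mu> < s" using factor.prems(1)[of \<mu>] by simp
  obtain K where K: "norm (a (Suc m) - \<mu> * a m) \<le> K * s ^ m" for m
    using factor.IH[of "\<lambda>m. a (Suc m) - \<mu> * a m"] factor.prems
    unfolding shift_poly_linear_factor by auto
  \<comment> \<open>\<open>K / (s - norm \<mu>)\<close> solves
    \<open>K + norm \<mu> * t = t * s\<close>, and a larger \<open>t\<close> keeps the inequality
    that the induction step needs. The maximum also covers \<open>m = 0\<close>.\<close>
  define K' where "K' = max (norm (a 0)) (K / (s - norm \<mu>))"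
  have "K / (s - norm \<mu>) \<le> K'" by (simp add: K'_def)
  with \<mu> have K': "K + norm \<mu> * K' \<le> K' * s" by (simp add: field_simps)
  have "norm (a m) \<le> K' * s ^ m" for m
  proof (induction m)
    case 0
    then show ?case by (simp add: K'_def)
  next
    case (Suc m)
    have "norm (a (Suc m)) \<le> norm (a (Suc m) - \<mu> * a m) + norm (\<mu> * a m)"
      using norm_triangle_ineq[of "a (Suc m) - \<mu> * a m" "\<mu> * a m"] by simp
    also have "\<dots> \<le> K * s ^ m + norm \<mu> * (K' * s ^ m)"
      using K[of m] Suc by (intro add_mono) (auto simp: norm_mult intro: mult_left_mono)
    also have "\<dots> = (K + norm \<mu> * K') * s ^ m" by (simp add: algebra_simps)
    also have "\<dots> \<le> (K' * s) * s ^ m" using K' \<open>0 < s\<close> by (intro mult_right_mono) auto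
    finally show ?case by (simp add: algebra_simps)
  qed
  then show ?case by blast
qed

text \<open>Roots that are not eigenvalues can be dropped from an annihilating polynomial of an orbit.\<close>
lemma annihilator_eigenvalue_roots:
  fixes N :: "complex ^ 'n ^ 'n" and p :: "complex poly"
  assumes "p \<noteq> 0" and z: "\<And>m. z (Suc m) = N *v z m"
    and "\<And>i m. shift_poly p (\<lambda>m. z m $ i) m = 0"
  shows "\<exists>p'. p' \<noteq> 0 \<and> (\<forall>\<mu>. poly p' \<mu> = 0 \<longrightarrow> (\<exists>u. u \<noteq> 0 \<and> N *v u = \<mu> *s u)) \<and>
    (\<forall>i m. shift_poly p' (\<lambda>m. z m $ i) m = 0)"
  using assms
proof (induction p arbitrary: z rule: poly_complex_induct)
  case (const c)
  then show ?case by (intro exI[of _ "[:c:]"]) auto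
next
  case (factor \<mu> q)
  show ?case
  proof (cases "\<exists>u. u \<noteq> 0 \<and> N *v u = \<mu> *s u")
    case True
    \<comment> \<open>For an eigenvalue the factor stays: \<open>z'\<close> is again an orbit of
      \<open>N\<close>, and an annihilator of \<open>z'\<close> times the linear factor annihilates
      \<open>z\<close>.\<close>
    define z' where "z' m = z (Suc m) - \<mu> *s z m" for m
    have step: "z' (Suc m) = N *v z' m" for m
      by (simp add: z'_def factor.prems(1) matrix_vector_mult_diff_distrib vec.scale)
    have act: "shift_poly ([:-\<mu>, 1:] * r) (\<lambda>m. z m $ i) m = shift_poly r (\<lambda>m. z' m $ i) m"
      for r i m
      unfolding shift_poly_linear_factor by (simp add: z'_def)
    obtain p' where p': "p' \<noteq> 0" "\<forall>\<mu>. poly p' \<mu> = 0 \<longrightarrow> (\<exists>u. u \<noteq> 0 \<and> N *v u = \<mu> *s u)"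
      "\<forall>i m. shift_poly p' (\<lambda>m. z' m $ i) m = 0"
      using factor.IH[of z', OF step] factor.prems(2) unfolding act by blast
    have "[:-\<mu>, 1:] * p' \<noteq> 0"
      using p'(1) by (intro no_zero_divisors) auto
    moreover have "\<exists>u. u \<noteq> 0 \<and> N *v u = l *s u" if "poly ([:-\<mu>, 1:] * p') l = 0" for l
      using that True p'(2) by auto
    ultimately show ?thesis using p'(3) act by metis
  next
    case False
    \<comment> \<open>\<open>u\<close> is \<open>q\<close> of the shift applied to \<open>z\<close>.
      It is an orbit of \<open>N\<close>, and the annihilating product forces
      \<open>N *v u m = \<mu> *s u m\<close>. Since \<open>\<mu>\<close> is not an eigenvalue,
      \<open>u\<close> vanishes, so \<open>q\<close> alone annihilates \<open>z\<close>.\<close>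
    define u where "u m = (\<chi> i. shift_poly q (\<lambda>m. z m $ i) m)" for m
    have "(N *v u m) $ i = u (Suc m) $ i" for i m
    proof -
      have "(N *v u m) $ i = (\<Sum>l\<le>degree q. \<Sum>j\<in>UNIV. N $ i $ j * (coeff q l * z (m + l) $ j))"
        by (simp add: u_def matrix_vector_mult_def shift_poly_def sum_distrib_left)
          (rule sum.swap)
      also have "\<dots> = (\<Sum>l\<le>degree q. coeff q l * (N *v z (m + l)) $ i)"
        by (simp add: matrix_vector_mult_def sum_distrib_left mult_ac)
      also have "\<dots> = u (Suc m) $ i"
        by (simp add: u_def shift_poly_def factor.prems(1))
      finally show ?thesis .
    qed
    moreover have "u (Suc m) $ i - \<mu> * u m $ i = 0" for i m
      using factor.prems(2)[of i m] unfolding shift_poly_linear_factor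
      by (simp add: u_def shift_poly_def algebra_simps sum_subtractf sum_distrib_left)
    ultimately have "N *v u m = \<mu> *s u m" for m
      by (simp add: vec_eq_iff)
    with False have "u m = 0" for m by blast
    then have "shift_poly q (\<lambda>m. z m $ i) m = 0" for i m
      by (simp add: u_def vec_eq_iff)
    with factor.IH[of z] factor.prems(1) show ?thesis by auto
  qed
qed

subsection \<open>Backward orbits of anti-stable matrices\<close>

lemma invertible_matrix_inv:
  assumes "invertible A"
  shows matrix_inv_right: "A ** matrix_inv A = mat 1"
    and matrix_inv_left: "matrix_inv A ** A = mat 1"
  using someI_ex[OF assms[unfolded invertible_def]] by (simp_all add: matrix_inv_def)

text \<open>The first \<open>d + 1\<close> points of the orbit are linearly dependent in real
  dimension \<open>d\<close>, and applying \<open>N\<close> carries this relation to every later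
  \<open>m\<close>. This replaces Cayley-Hamilton; roots foreign to \<open>N\<close> are removed by
  \<open>annihilator_eigenvalue_roots\<close>.\<close>

lemma annihilator_exists:
  fixes N :: "complex ^ 'n ^ 'n"
  assumes z: "\<And>m. z (Suc m) = N *v z m"
  shows "\<exists>p :: complex poly. p \<noteq> 0 \<and> (\<forall>i m. shift_poly p (\<lambda>m. z m $ i) m = 0)"
proof -
  define d where "d = DIM(complex ^ 'n)"
  have "\<exists>c :: nat \<Rightarrow> real. (\<exists>l\<le>d. c l \<noteq> 0) \<and> (\<Sum>l\<le>d. c l *\<^sub>R z l) = 0"
  \<comment> \<open>Dependence speaks of sets of vectors, so a repetition in the list is a separate
    case, with the relation \<open>z i - z j = 0\<close>.\<close>
  proof (cases "inj_on z {..d}")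
    case True
    have "card (z ` {..d}) > DIM(complex ^ 'n)"
      using card_image[OF True] by (simp add: d_def)
    then have "dependent (z ` {..d})"
      by (intro dependent_biggerset) auto
    then obtain u where u: "\<exists>v\<in>z ` {..d}. u v \<noteq> 0" "(\<Sum>v\<in>z ` {..d}. u v *\<^sub>R v) = 0"
      by (subst (asm) real_vector.dependent_finite) auto
    then show ?thesis
      by (intro exI[of _ "\<lambda>l. u (z l)"]) (auto simp: sum.reindex[OF True])
  next
    case False
    then obtain i j where ij: "i \<le> d" "j \<le> d" "z i = z j" "i \<noteq> j"
      by (auto simp: inj_on_def)
    define c :: "nat \<Rightarrow> real" where "c l = of_bool (l = i) - of_bool (l = j)" for l
    have "(\<Sum>l\<le>d. c l *\<^sub>R z l) = (\<Sum>l\<le>d. if l = i then z l else 0) - (\<Sum>l\<le>d. if l = j then z l else 0)"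
      by (subst sum_subtractf[symmetric], rule sum.cong) (auto simp: c_def)
    also have "\<dots> = 0" using ij by simp
    finally show ?thesis using ij by (intro exI[of _ c]) (auto simp: c_def)
  qed
  then obtain c :: "nat \<Rightarrow> real" and l0
    where c: "l0 \<le> d" "c l0 \<noteq> 0" "(\<Sum>l\<le>d. c l *\<^sub>R z l) = 0" by blast
  define p where "p = (\<Sum>l\<le>d. monom (complex_of_real (c l)) l)"
  have "coeff p l0 = c l0"
    using c(1) by (simp add: p_def coeff_sum)
  with c have "p \<noteq> 0" by auto
  have lin: "N *v (\<Sum>l\<in>I. of_real (c l) *s z (m + l)) = (\<Sum>l\<in>I. of_real (c l) *s z (Suc m + l))"
    for I m
    by (induction I rule: infinite_finite_induct)
      (simp_all add: matrix_vector_right_distrib vec.scale z)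
  have zero: "(\<Sum>l\<le>d. complex_of_real (c l) *s z (m + l)) = 0" for m
  proof (induction m)
    case 0
    have "complex_of_real a *s y = a *\<^sub>R y" for a and y :: "complex ^ 'n"
      by (simp add: vec_eq_iff) (simp add: scaleR_conv_of_real)
    with c show ?case by simp
  next
    case (Suc m)
    show ?case unfolding lin[symmetric] Suc by simp
  qed
  have "shift_poly p (\<lambda>m. z m $ i) m = 0" for i m
    using arg_cong[OF zero[of m], of "\<lambda>v. v $ i"]
    by (simp add: p_def shift_poly_sum shift_poly_monom)
  with \<open>p \<noteq> 0\<close> show ?thesis by blast
qed

lemma map_matrix_of_real_mult:
  fixes A :: "real ^ 'n ^ 'm" and B :: "real ^ 'l ^ 'n"
  shows "map_matrix complex_of_real (A ** B) = map_matrix of_real A ** map_matrix of_real B"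
  by (simp add: vec_eq_iff matrix_matrix_mult_def)

lemma map_matrix_of_real_mult_vector:
  "map_matrix complex_of_real A *v (\<chi> i. of_real (x $ i)) = (\<chi> i. of_real ((A *v x) $ i))"
  by (simp add: vec_eq_iff matrix_vector_mult_def)

text \<open>A nonzero kernel vector, complexified, would be an eigenvector for the eigenvalue
  0.\<close>

lemma anti_stable_invertible:
  fixes A :: "real ^ 'n ^ 'n"
  assumes "anti_stable A"
  shows "invertible A"
proof (rule ccontr)
  assume "\<not> invertible A"
  then obtain x where x: "A *v x = 0" "x \<noteq> 0"
    by (auto simp: invertible_left_inverse matrix_left_invertible_ker)
  define w where "w = (\<chi> i. complex_of_real (x $ i))"
  have "map_matrix complex_of_real A *v w = 0 *s w"
    unfolding w_def map_matrix_of_real_mult_vector by (simp add: x vec_eq_iff)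
  moreover have "w \<noteq> 0" using x by (auto simp: w_def vec_eq_iff)
  ultimately have "is_eigenvalue A 0" by (auto simp: is_eigenvalue_def)
  with assms show False by (force simp: anti_stable_def)
qed

text \<open>Eigenvalues of the inverse are reciprocals: applying \<open>A\<close> to the eigenvector
  equation of \<open>B\<close> makes \<open>1 / \<mu>\<close> an eigenvalue of
  \<open>A\<close>.\<close>

lemma anti_stable_inverse_eigenvalue:
  fixes A B :: "real ^ 'n ^ 'n"
  assumes "anti_stable A" and "A ** B = mat 1"
    and u: "u \<noteq> 0" "map_matrix complex_of_real B *v u = \<mu> *s u"
  shows "norm \<mu> \<le> 1"
proof -
  let ?A = "map_matrix complex_of_real A"
  have "map_matrix complex_of_real (mat 1 :: real ^ 'n ^ 'n) = mat 1"
    by (simp add: vec_eq_iff mat_def)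
  then have "?A *v (map_matrix complex_of_real B *v u) = u"
    by (simp add: matrix_vector_mul_assoc map_matrix_of_real_mult[symmetric] assms(2))
  then have *: "\<mu> *s (?A *v u) = u" by (simp add: u vec.scale)
  with u have "\<mu> \<noteq> 0" by auto
  have "(1 / \<mu>) *s u = (1 / \<mu>) *s (\<mu> *s (?A *v u))" by (simp only: *)
  also have "\<dots> = ?A *v u" using \<open>\<mu> \<noteq> 0\<close> by (simp add: vector_smult_assoc)
  finally have "is_eigenvalue A (1 / \<mu>)" using u(1) unfolding is_eigenvalue_def by metis
  with assms(1) have "1 \<le> norm (1 / \<mu>)" by (auto simp: anti_stable_def)
  with \<open>\<mu> \<noteq> 0\<close> show ?thesis by (simp add: norm_divide field_simps)
qed

text \<open>Each coordinate of the orbit obeys a recurrence whose roots are eigenvalues of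
  \<open>B\<close>, of modulus at most 1. Jordan blocks on the unit circle may cause polynomial
  growth, hence a bound by powers of \<open>s > 1\<close>.\<close>

lemma anti_stable_inverse_power_growth:
  fixes A B :: "real ^ 'n ^ 'n" and C :: "real ^ 'n ^ 'm"
  assumes "anti_stable A" and "A ** B = mat 1" and "1 < s"
  shows "\<exists>K. \<forall>m. \<bar>(C *v (matrix_power B m *v x)) $ j\<bar> \<le> K * s ^ m"
proof -
  define N where "N = map_matrix complex_of_real B"
  define z where "z m = (\<chi> i. complex_of_real ((matrix_power B m *v x) $ i))" for m
  have z: "z (Suc m) = N *v z m" for m
    unfolding N_def z_def map_matrix_of_real_mult_vector
    by (simp add: matrix_vector_mul_assoc)
  obtain p0 :: "complex poly" where "p0 \<noteq> 0" "\<And>i m. shift_poly p0 (\<lambda>m. z m $ i) m = 0"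
    using annihilator_exists[of z N, OF z] by metis
  then obtain p where p: "p \<noteq> 0" "\<forall>\<mu>. poly p \<mu> = 0 \<longrightarrow> (\<exists>u. u \<noteq> 0 \<and> N *v u = \<mu> *s u)"
    "\<forall>i m. shift_poly p (\<lambda>m. z m $ i) m = 0"
    using annihilator_eigenvalue_roots[of p0 z N, OF _ z] by blast
  have "\<exists>K. \<forall>m. norm (z m $ i) \<le> K * s ^ m" for i
  proof (rule recurrence_growth[OF p(1)])
    fix \<mu> assume "poly p \<mu> = 0"
    then have "norm \<mu> \<le> 1"
      using p(2) anti_stable_inverse_eigenvalue[OF assms(1,2)] unfolding N_def by metis
    then show "norm \<mu> < s" using assms(3) by simp
  qed (use assms(3) p(3) in auto)
  then obtain K where K: "\<bar>(matrix_power B m *v x) $ i\<bar> \<le> K i * s ^ m" for i m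
    unfolding z_def by (simp add: norm_of_real) metis
  have "\<bar>(C *v (matrix_power B m *v x)) $ j\<bar> \<le> (\<Sum>i\<in>UNIV. \<bar>C $ j $ i\<bar> * K i) * s ^ m" for m
  proof -
    have "\<bar>(C *v (matrix_power B m *v x)) $ j\<bar>
        \<le> (\<Sum>i\<in>UNIV. \<bar>C $ j $ i\<bar> * \<bar>(matrix_power B m *v x) $ i\<bar>)"
      unfolding matrix_vector_mult_def[of C] by (simp add: abs_mult[symmetric])
    also have "\<dots> \<le> (\<Sum>i\<in>UNIV. \<bar>C $ j $ i\<bar> * (K i * s ^ m))"
      by (intro sum_mono mult_left_mono K) auto
    finally show ?thesis by (simp add: sum_distrib_right mult.assoc)
  qed
  then show ?thesis by blast
qed

subsection \<open>Causal filters on sequences of moderate growth\<close>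

text \<open>Serves for both polynomials of the filter: the numerator directly, the denominator with
  the coefficients \<open>- f i\<close>.\<close>

definition ma_fps :: "nat \<Rightarrow> (nat \<Rightarrow> real) \<Rightarrow> real fps" where
  "ma_fps q g = 1 + (\<Sum>j=1..q. fps_const (g j) * fps_X ^ j)"

text \<open>Treats the leading 1 of a moving average as a coefficient with index 0, so that a single
  sum suffices.\<close>

lemma sum_atMost_fun_upd_0:
  fixes g :: "nat \<Rightarrow> 'b :: zero"
  shows "(\<Sum>j\<le>q. F j ((g(0 := c)) j)) = F 0 c + (\<Sum>j=1..q. F j (g j) :: 'a :: comm_monoid_add)"
proof -
  have "{..q} = insert 0 {1..q}" by auto
  then show ?thesis by (auto intro!: sum.cong)
qed

lemma ma_fps_eq_sum: "ma_fps q g = (\<Sum>j\<le>q. fps_const ((g(0 := 1)) j) * fps_X ^ j)"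
  by (subst sum_atMost_fun_upd_0) (simp add: ma_fps_def)

lemma ma_fps_mult_nth:
  "fps_nth (ma_fps q g * H) n = (\<Sum>j\<le>q. (g(0 := 1)) j * (if n < j then 0 else fps_nth H (n - j)))"
  by (simp only: ma_fps_eq_sum sum_distrib_right fps_sum_nth mult.assoc fps_mult_left_const_nth
      fps_X_power_mult_nth)

lemma ma_fps_nth_0 [simp]: "fps_nth (ma_fps q g) 0 = 1"
  by (simp add: ma_fps_def fps_sum_nth)

lemma ma_fps_mult_inverse: "ma_fps q g * inverse (ma_fps q g) = 1"
  by (simp add: inverse_mult_eq_1')

definition geom_decay :: "real \<Rightarrow> real fps \<Rightarrow> bool" where
  "geom_decay r H \<longleftrightarrow> (\<exists>D. \<forall>n. \<bar>fps_nth H n\<bar> \<le> D * r ^ n)"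

text \<open>The counterpart of \<open>geom_decay\<close>: for \<open>r * s < 1\<close> the filter
  series converges absolutely. The constant may depend on \<open>k\<close>, the rate may
  not.\<close>

definition past_growth :: "real \<Rightarrow> (int \<Rightarrow> real) \<Rightarrow> bool" where
  "past_growth s u \<longleftrightarrow> (\<forall>k. \<exists>K. \<forall>m. \<bar>u (k - int m)\<bar> \<le> K * s ^ m)"

lemma geom_decay_mono:
  assumes "geom_decay r H" and "0 \<le> r" and "r \<le> r'"
  shows "geom_decay r' H"
proof -
  obtain D where D: "\<And>n. \<bar>fps_nth H n\<bar> \<le> D * r ^ n"
    using assms(1) by (auto simp: geom_decay_def)
  have "0 \<le> D" using D[of 0] by simp
  have "\<bar>fps_nth H n\<bar> \<le> D * r' ^ n" for n
    using D[of n] mult_left_mono[OF power_mono[OF assms(3,2), of n] \<open>0 \<le> D\<close>] by linarith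
  then show ?thesis by (auto simp: geom_decay_def)
qed

text \<open>The product is a finite combination of delayed copies of \<open>H\<close>. A delay by
  \<open>j\<close> multiplies the constant by \<open>1 / r ^ j\<close> and keeps the rate.\<close>

lemma geom_decay_ma_fps_mult:
  assumes "geom_decay r H" and "0 < r"
  shows "geom_decay r (ma_fps q g * H)"
proof -
  obtain D where D: "\<And>n. \<bar>fps_nth H n\<bar> \<le> D * r ^ n"
    using assms(1) by (auto simp: geom_decay_def)
  have "0 \<le> D" using D[of 0] by simp
  define c where "c = g(0 := 1)"
  have "\<bar>fps_nth (ma_fps q g * H) n\<bar> \<le> (\<Sum>j\<le>q. \<bar>c j\<bar> * (D / r ^ j)) * r ^ n" for n
  proof -
    have "\<bar>if n < j then 0 else fps_nth H (n - j)\<bar> \<le> D / r ^ j * r ^ n" for j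
      using D[of "n - j"] \<open>0 \<le> D\<close> \<open>0 < r\<close> by (auto simp: power_diff)
    then have "(\<Sum>j\<le>q. \<bar>c j * (if n < j then 0 else fps_nth H (n - j))\<bar>)
        \<le> (\<Sum>j\<le>q. \<bar>c j\<bar> * (D / r ^ j * r ^ n))"
      unfolding abs_mult by (intro sum_mono mult_left_mono) auto
    then show ?thesis
      unfolding ma_fps_mult_nth c_def[symmetric]
      by (intro order_trans[OF sum_abs]) (simp add: sum_distrib_right mult.assoc)
  qed
  then show ?thesis by (auto simp: geom_decay_def)
qed

text \<open>The coefficients of the inverse series satisfy a linear recurrence whose characteristic
  roots are 0 and the zeros of the moving average. These are finitely many, so some
  \<open>r < 1\<close> exceeds all their moduli.\<close>

lemma minimum_phase_geom_decay:
  assumes "minimum_phase q g"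
  shows "\<exists>r. 0 < r \<and> r < 1 \<and> geom_decay r (inverse (ma_fps q g))"
proof -
  define c where "c = g(0 := 1)"
  define e where "e = inverse (ma_fps q g)"
  \<comment> \<open>\<open>Q\<close> is the moving average times \<open>z ^ Suc q\<close>. The
    exponent is \<open>Suc q\<close> rather than \<open>q\<close> so that the recurrence only
    involves coefficients of the product with index at least 1, which vanish even when
    \<open>q = 0\<close>. The extra root 0 is harmless.\<close>
  define Q where "Q = (\<Sum>j\<le>q. monom (complex_of_real (c j)) (Suc q - j))"
  have "coeff Q (Suc q) = (\<Sum>j\<le>q. if j = 0 then 1 else 0)"
    unfolding Q_def coeff_sum by (rule sum.cong) (auto simp: c_def)
  then have "coeff Q (Suc q) = 1" by simp
  then have "Q \<noteq> 0" by auto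
  have root: "norm z < 1" if "poly Q z = 0" for z
  proof (cases "z = 0")
    case False
    have "poly Q z = (\<Sum>j\<le>q. z ^ Suc q * (of_real (c j) / z ^ j))"
      unfolding Q_def poly_sum poly_monom
      by (rule sum.cong) (use False in \<open>auto simp: power_diff simp del: power_Suc\<close>)
    also have "\<dots> = z ^ Suc q * (\<Sum>j\<le>q. of_real (c j) / z ^ j)"
      by (simp only: sum_distrib_left)
    also have "(\<Sum>j\<le>q. of_real (c j) / z ^ j) = 1 + (\<Sum>j=1..q. of_real (g j) / z ^ j)"
      unfolding c_def by (subst sum_atMost_fun_upd_0) simp
    finally show ?thesis using assms that False by (auto simp: minimum_phase_def)
  qed simp
  \<comment> \<open>Including 0 makes \<open>Max R\<close> visibly well defined and nonnegative;
    \<open>r\<close> is then the midpoint of \<open>Max R\<close> and 1.\<close>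
  define R where "R = insert (0::real) (norm ` {z. poly Q z = 0})"
  have R: "finite R" "\<And>t. t \<in> R \<Longrightarrow> t < 1" "0 \<in> R"
    using poly_roots_finite[OF \<open>Q \<noteq> 0\<close>] root by (auto simp: R_def)
  then have Max: "Max R \<in> R" by (intro Max_in) auto
  define r where "r = (Max R + 1) / 2"
  have "Max R < 1" "0 \<le> Max R" using R Max by auto
  then have r: "0 < r" "r < 1" by (auto simp: r_def)
  have "norm z < r" if "poly Q z = 0" for z
  proof -
    have "norm z \<le> Max R" using that R(1) by (intro Max_ge) (auto simp: R_def)
    with \<open>Max R < 1\<close> show ?thesis by (simp add: r_def)
  qed
  moreover have "shift_poly Q (\<lambda>n. complex_of_real (fps_nth e n)) m = 0" for m
  proof -
    have "shift_poly Q (\<lambda>n. complex_of_real (fps_nth e n)) m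
        = of_real (\<Sum>j\<le>q. c j * fps_nth e (m + Suc q - j))"
      by (simp add: Q_def shift_poly_sum shift_poly_monom)
    also have "(\<Sum>j\<le>q. c j * fps_nth e (m + Suc q - j)) = fps_nth (ma_fps q g * e) (m + Suc q)"
      unfolding ma_fps_mult_nth c_def by (rule sum.cong) auto
    also have "\<dots> = 0" by (simp add: e_def ma_fps_mult_inverse)
    finally show ?thesis by simp
  qed
  ultimately obtain K where "\<forall>m. norm (complex_of_real (fps_nth e m)) \<le> K * r ^ m"
    using recurrence_growth[OF \<open>Q \<noteq> 0\<close>, of r] r by meson
  with r show ?thesis by (auto simp: geom_decay_def e_def)
qed

lemma past_growth_add:
  assumes "past_growth s u" and "past_growth s w"
  shows "past_growth s (\<lambda>k. u k + w k)"
  unfolding past_growth_def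
proof
  fix k
  obtain K L where "\<And>m. \<bar>u (k - int m)\<bar> \<le> K * s ^ m" "\<And>m. \<bar>w (k - int m)\<bar> \<le> L * s ^ m"
    using assms unfolding past_growth_def by metis
  then have "\<bar>u (k - int m) + w (k - int m)\<bar> \<le> (K + L) * s ^ m" for m
    unfolding distrib_right by (intro order_trans[OF abs_triangle_ineq] add_mono)
  then show "\<exists>K. \<forall>m. \<bar>u (k - int m) + w (k - int m)\<bar> \<le> K * s ^ m" by blast
qed

text \<open>Decay \<open>r ^ m\<close> meets growth \<open>s ^ (m + j)\<close>. One \<open>E\<close>
  serves all \<open>j\<close>, as needed to bound the filter output at all past times.\<close>

lemma geom_decay_past_growth_bound:
  assumes "geom_decay r H" and "past_growth s u" and "0 \<le> r" and "0 \<le> s"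
  shows "\<exists>E. \<forall>m j. \<bar>fps_nth H m * u (k - int (m + j))\<bar> \<le> E * s ^ j * (r * s) ^ m"
proof -
  obtain D where D: "\<And>n. \<bar>fps_nth H n\<bar> \<le> D * r ^ n"
    using assms(1) by (auto simp: geom_decay_def)
  obtain K where K: "\<And>m. \<bar>u (k - int m)\<bar> \<le> K * s ^ m"
    using assms(2) unfolding past_growth_def by metis
  have "\<bar>fps_nth H m * u (k - int (m + j))\<bar> \<le> (D * K) * s ^ j * (r * s) ^ m" for m j
  proof -
    have "\<bar>fps_nth H m * u (k - int (m + j))\<bar> \<le> (D * r ^ m) * (K * s ^ (m + j))"
      unfolding abs_mult by (intro mult_mono D K) (use order_trans[OF abs_ge_zero D] in auto)
    then show ?thesis by (simp add: power_add power_mult_distrib mult_ac)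
  qed
  then show ?thesis by blast
qed

lemma geom_decay_past_growth_summable:
  assumes "geom_decay r H" and "past_growth s u" and "0 \<le> r" and "0 \<le> s" and "r * s < 1"
  shows "summable (\<lambda>m. \<bar>fps_nth H m * u (k - int (m + j))\<bar>)"
proof -
  obtain E where "\<And>m. \<bar>fps_nth H m * u (k - int (m + j))\<bar> \<le> E * s ^ j * (r * s) ^ m"
    using geom_decay_past_growth_bound[OF assms(1-4)] by metis
  then show ?thesis
    using assms(3-5) by (intro summable_comparison_test'[OF summable_mult[OF summable_geometric]])
      (auto simp: abs_mult)
qed

text \<open>Summing the geometric bound over \<open>m\<close> leaves the constant
  \<open>E / (1 - r * s)\<close> times \<open>s ^ j\<close>.\<close>

lemma past_growth_filter:
  assumes "geom_decay r H" and "past_growth s u" and "0 \<le> r" and "0 \<le> s" and "r * s < 1"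
    and w: "\<And>k. (\<lambda>m. fps_nth H m * u (k - int m)) sums w k"
  shows "past_growth s w"
  unfolding past_growth_def
proof
  fix k
  obtain E where E: "\<And>m j. \<bar>fps_nth H m * u (k - int (m + j))\<bar> \<le> E * s ^ j * (r * s) ^ m"
    using geom_decay_past_growth_bound[OF assms(1-4)] by metis
  have "\<bar>w (k - int j)\<bar> \<le> (E / (1 - r * s)) * s ^ j" for j
  proof -
    have "(\<lambda>m. fps_nth H m * u (k - int (m + j))) sums w (k - int j)"
      using w[of "k - int j"] by (simp add: algebra_simps)
    then have "w (k - int j) = (\<Sum>m. fps_nth H m * u (k - int (m + j)))"
      by (rule sums_unique)
    then have "\<bar>w (k - int j)\<bar> \<le> (\<Sum>m. \<bar>fps_nth H m * u (k - int (m + j))\<bar>)"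
      using summable_rabs[OF geom_decay_past_growth_summable[OF assms(1-5), of k j]] by simp
    also have "\<dots> \<le> (\<Sum>m. E * s ^ j * (r * s) ^ m)"
      using assms(3-5)
      by (intro suminf_le[OF E geom_decay_past_growth_summable[OF assms(1-5)]]
          summable_mult summable_geometric) (auto simp: abs_mult)
    also have "\<dots> = E * s ^ j / (1 - r * s)"
      using assms(3-5) by (subst suminf_mult) (auto simp: abs_mult suminf_geometric intro!: summable_geometric)
    finally show ?thesis by simp
  qed
  then show "\<exists>K. \<forall>m. \<bar>w (k - int m)\<bar> \<le> K * s ^ m" by blast
qed

text \<open>Filtering by the product equals taking the moving average of \<open>u\<close> and then
  filtering by \<open>H\<close>. The rearrangement is a finite sum of convergent series
  \<open>S j\<close>, one for each delay \<open>j\<close>.\<close>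

lemma ma_fps_mult_filter_sums:
  assumes "geom_decay r H" and "past_growth s u" and "0 \<le> r" and "0 \<le> s" and "r * s < 1"
  shows "(\<lambda>n. fps_nth (ma_fps q g * H) n * u (k - int n)) sums
    (\<Sum>m. fps_nth H m * (u (k - int m) + (\<Sum>j=1..q. g j * u (k - int m - int j))))"
proof -
  define c where "c = g(0 := 1)"
  define S where "S j = (\<Sum>m. fps_nth H m * u (k - int (m + j)))" for j
  have S: "(\<lambda>m. fps_nth H m * u (k - int (m + j))) sums S j" for j
    using summable_rabs_cancel[OF geom_decay_past_growth_summable[OF assms]]
    by (simp add: S_def summable_sums)
  \<comment> \<open>Substituting \<open>n = m + j\<close> only prepends \<open>j\<close> zero
    terms.\<close>
  have "(\<lambda>n. (if n < j then 0 else fps_nth H (n - j)) * u (k - int n)) sums S j" for j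
    using S[of j] by (subst sums_iff_shift'[of _ j, symmetric]) auto
  then have 1: "(\<lambda>n. \<Sum>j\<le>q. c j * ((if n < j then 0 else fps_nth H (n - j)) * u (k - int n)))
      sums (\<Sum>j\<le>q. c j * S j)"
    by (intro sums_sum sums_mult)
  have 2: "(\<lambda>m. \<Sum>j\<le>q. c j * (fps_nth H m * u (k - int (m + j)))) sums (\<Sum>j\<le>q. c j * S j)"
    by (intro sums_sum sums_mult S)
  have "(\<Sum>j\<le>q. c j * (fps_nth H m * u (k - int (m + j))))
      = fps_nth H m * (u (k - int m) + (\<Sum>j=1..q. g j * u (k - int m - int j)))" for m
  proof -
    have "(\<Sum>j\<le>q. c j * (fps_nth H m * u (k - int (m + j))))
        = fps_nth H m * (\<Sum>j\<le>q. c j * u (k - int m - int j))"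
      by (simp add: sum_distrib_left algebra_simps)
    also have "(\<Sum>j\<le>q. c j * u (k - int m - int j))
        = u (k - int m) + (\<Sum>j=1..q. g j * u (k - int m - int j))"
      unfolding c_def by (subst sum_atMost_fun_upd_0) simp
    finally show ?thesis .
  qed
  then have "(\<Sum>m. fps_nth H m * (u (k - int m) + (\<Sum>j=1..q. g j * u (k - int m - int j))))
      = (\<Sum>j\<le>q. c j * S j)"
    using sums_unique[OF 2] by simp
  then show ?thesis
    using 1 by (simp add: ma_fps_mult_nth c_def sum_distrib_right mult.assoc)
qed

text \<open>Of all solutions \<open>w\<close> of the recursion, the one of moderate growth in the past is the
  output of the causal filter: cancel the moving average by its inverse on both sides.\<close>
lemma recursion_filter_sums:
  assumes "geom_decay r (inverse (ma_fps q g))" and "0 \<le> r" and "0 \<le> s" and "r * s < 1"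
    and "past_growth s u" and "past_growth s w"
    and rec: "\<And>k. w k + (\<Sum>j=1..q. g j * w (k - int j)) = u k + (\<Sum>i=1..p. f i * u (k - int i))"
  shows "(\<lambda>n. fps_nth (ma_fps p f * inverse (ma_fps q g)) n * u (k - int n)) sums w k"
proof -
  have "(\<lambda>n. fps_nth (ma_fps q g * inverse (ma_fps q g)) n * w (k - int n)) sums
      (\<Sum>m. fps_nth (inverse (ma_fps q g)) m * (w (k - int m) + (\<Sum>j=1..q. g j * w (k - int m - int j))))"
    by (rule ma_fps_mult_filter_sums) fact+
  moreover have "(\<lambda>n. fps_nth (ma_fps q g * inverse (ma_fps q g)) n * w (k - int n)) sums w k"
    using sums_single[of 0 "\<lambda>n. w (k - int n)"]
    by (simp add: ma_fps_mult_inverse if_distrib if_distribR cong: if_cong)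
  \<comment> \<open>The same series has two limits, one of them \<open>w k\<close> because the
    product is 1; \<open>rec\<close> turns the moving average of \<open>w\<close> into that of
    \<open>u\<close>.\<close>
  ultimately have "w k = (\<Sum>m. fps_nth (inverse (ma_fps q g)) m *
      (u (k - int m) + (\<Sum>i=1..p. f i * u (k - int m - int i))))"
    unfolding rec by (rule sums_unique2[symmetric])
  then show ?thesis
    using ma_fps_mult_filter_sums[of r "inverse (ma_fps q g)" s u p f k] assms by simp
qed

text \<open>Makes the decay result for zeros available for poles.\<close>

lemma stable_filter_iff_minimum_phase: "stable_filter p f \<longleftrightarrow> minimum_phase p (\<lambda>i. - f i)"
  by (simp add: stable_filter_def minimum_phase_def sum_negf)

lemma arma_filter_eq: "arma_filter p f q g = ma_fps q g * inverse (ma_fps p (\<lambda>i. - f i))"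
proof -
  have "1 - (\<Sum>i=1..p. fps_const (f i) * fps_X ^ i) = ma_fps p (\<lambda>i. - f i)"
    by (simp add: ma_fps_def sum_negf fps_const_neg[symmetric] del: fps_const_neg)
  then show ?thesis
    unfolding arma_filter_def ma_fps_def[of q g, symmetric] by (simp add: fps_divide_unit)
qed

lemma inverse_arma_filter_eq:
  "inverse (arma_filter p f q g) = ma_fps p (\<lambda>i. - f i) * inverse (ma_fps q g)"
  by (simp add: arma_filter_eq fps_inverse_mult fps_inverse_idempotent mult.commute)

text \<open>The numerator of the filter preserves the decay rate of the inverse denominator, so ARMA
  noise inherits moderate growth from its driving noise.\<close>

lemma arma_past_growth:
  assumes "geom_decay r (inverse (ma_fps p (\<lambda>i. - f i)))"
    and "0 < r" and "0 \<le> s" and "r * s < 1" and "past_growth s u"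
    and "\<And>k. (\<lambda>m. fps_nth (arma_filter p f q g) m * u (k - int m)) sums w k"
  shows "past_growth s w"
  using assms(6) unfolding arma_filter_eq
  by (rule past_growth_filter[OF geom_decay_ma_fps_mult[OF assms(1,2)] assms(5)
        less_imp_le[OF assms(2)] assms(3,4)])

subsection \<open>Almost sure growth of the noise\<close>

lemma (in prob_space) AE_past_growth:
  fixes u :: "int \<Rightarrow> 'a \<Rightarrow> real"
  assumes [measurable]: "\<And>k. u k \<in> borel_measurable M"
    and c: "\<And>k. (\<integral>\<^sup>+\<omega>. ennreal \<bar>u k \<omega>\<bar> \<partial>M) \<le> ennreal c" and "1 < s"
  shows "AE \<omega> in M. past_growth s (\<lambda>k. u k \<omega>)"
  unfolding past_growth_def
proof (subst AE_all_countable, intro allI)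
  fix k
  \<comment> \<open>The expectation of \<open>Z\<close> is at most a geometric series times
    \<open>c\<close>, so \<open>Z\<close> is finite almost surely. A finite value bounds every
    single term of the series and serves as the constant \<open>K\<close>.\<close>
  define Z where "Z \<omega> = (\<Sum>m. ennreal ((1 / s) ^ m) * ennreal \<bar>u (k - int m) \<omega>\<bar>)" for \<omega>
  have [measurable]: "Z \<in> borel_measurable M" unfolding Z_def by measurable
  have "(\<integral>\<^sup>+\<omega>. Z \<omega> \<partial>M) = (\<Sum>m. ennreal ((1 / s) ^ m) * (\<integral>\<^sup>+\<omega>. ennreal \<bar>u (k - int m) \<omega>\<bar> \<partial>M))"
    unfolding Z_def by (subst nn_integral_suminf) (simp_all add: nn_integral_cmult)
  also have "\<dots> \<le> (\<Sum>m. ennreal ((1 / s) ^ m) * ennreal c)"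
    by (intro suminf_le mult_left_mono c) auto
  also have "\<dots> = (\<Sum>m. ennreal ((1 / s) ^ m)) * ennreal c"
    by simp
  also have "(\<Sum>m. ennreal ((1 / s) ^ m)) = ennreal (\<Sum>m. (1 / s) ^ m)"
    using \<open>1 < s\<close> by (intro suminf_ennreal2 summable_geometric) auto
  finally have "(\<integral>\<^sup>+\<omega>. Z \<omega> \<partial>M) \<noteq> \<infinity>"
    by (auto simp: top_unique ennreal_mult_eq_top_iff)
  then have "AE \<omega> in M. Z \<omega> \<noteq> \<infinity>" by (intro nn_integral_PInf_AE) auto
  then show "AE \<omega> in M. \<exists>K. \<forall>m. \<bar>u (k - int m) \<omega>\<bar> \<le> K * s ^ m"
  proof eventually_elim
    case (elim \<omega>)
    have "\<bar>u (k - int m) \<omega>\<bar> \<le> enn2real (Z \<omega>) * s ^ m" for m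
    proof -
      have "ennreal ((1 / s) ^ m * \<bar>u (k - int m) \<omega>\<bar>) = ennreal ((1 / s) ^ m) * ennreal \<bar>u (k - int m) \<omega>\<bar>"
        using \<open>1 < s\<close> by (intro ennreal_mult) auto
      also have "\<dots> \<le> Z \<omega>"
        unfolding Z_def using sum_le_suminf[of "\<lambda>m. ennreal ((1 / s) ^ m) * ennreal \<bar>u (k - int m) \<omega>\<bar>" "{m}"]
        by (simp add: summableI)
      also have "\<dots> = ennreal (enn2real (Z \<omega>))" using elim by (simp add: less_top)
      finally have "(1 / s) ^ m * \<bar>u (k - int m) \<omega>\<bar> \<le> enn2real (Z \<omega>)" by simp
      then show ?thesis using \<open>1 < s\<close> by (simp add: power_one_over field_simps)
    qed
    then show ?case by blast
  qed
qed

text \<open>All \<open>u k\<close> share one Gaussian density with finite first absolute moment, so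
  the same \<open>c\<close> works for every \<open>k\<close>.\<close>

lemma white_gaussian_moments:
  assumes "prob_space M" and "0 < \<sigma>" and "white_gaussian M \<sigma> u"
  shows "zero_mean M u"
    and "\<exists>c. \<forall>k. (\<integral>\<^sup>+\<omega>. ennreal \<bar>u k \<omega>\<bar> \<partial>M) \<le> ennreal c"
proof -
  have D: "distributed M lborel (u k) (normal_density 0 \<sigma>)" for k
    using assms(3) by (simp add: white_gaussian_def)
  have "integrable M (u k)" for k
    using integrable_normal_moment_nz_1[OF assms(2), of 0]
    by (intro distributed_integrable_var[OF D]) auto
  then show "zero_mean M u"
    using prob_space.normal_distributed_expectation[OF assms(1,2) D]
    by (simp add: zero_mean_def)
  define c where "c = (\<integral>x. normal_density 0 \<sigma> x * \<bar>x\<bar> \<partial>lborel)"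
  have "(\<integral>\<^sup>+\<omega>. ennreal \<bar>u k \<omega>\<bar> \<partial>M) = ennreal c" for k
  proof -
    have "(\<integral>\<^sup>+\<omega>. ennreal \<bar>u k \<omega>\<bar> \<partial>M)
        = (\<integral>\<^sup>+x. ennreal (normal_density 0 \<sigma> x) * ennreal \<bar>x\<bar> \<partial>lborel)"
      by (rule distributed_nn_integral[OF D, symmetric]) simp
    also have "\<dots> = (\<integral>\<^sup>+x. ennreal (normal_density 0 \<sigma> x * \<bar>x\<bar>) \<partial>lborel)"
      by (simp add: ennreal_mult)
    also have "\<dots> = ennreal c"
      unfolding c_def using integrable_normal_moment_abs[OF assms(2), of 0 1]
      by (intro nn_integral_eq_integral) auto
    finally show ?thesis .
  qed
  then show "\<exists>c. \<forall>k. (\<integral>\<^sup>+\<omega>. ennreal \<bar>u k \<omega>\<bar> \<partial>M) \<le> ennreal c" by (intro exI[of _ c]) simp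
qed

lemma zero_mean_output:
  fixes C :: "real ^ 'n ^ 1"
  assumes "zero_mean M x" and "zero_mean M u"
  shows "zero_mean M (\<lambda>k \<omega>. (C *v x k \<omega>) $ 1 + u k \<omega>)"
proof -
  have "bounded_linear ((*v) C)"
    by (simp add: linear_conv_bounded_linear[symmetric])
  then have bl: "bounded_linear (\<lambda>y. (C *v y) $ 1)"
    by (intro bounded_linear_compose[OF bounded_linear_vec_nth])
  have "integrable M (\<lambda>\<omega>. (C *v x k \<omega>) $ 1)" "(\<integral>\<omega>. (C *v x k \<omega>) $ 1 \<partial>M) = 0" for k
    using integrable_bounded_linear[OF bl, of M "x k"] integral_bounded_linear[OF bl, of M "x k"] assms(1)
    by (simp_all add: zero_mean_def)
  with assms(2) show ?thesis by (simp add: zero_mean_def)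
qed

subsection \<open>The filtered plant\<close>

lemma backward_orbit:
  fixes A B :: "real ^ 'n ^ 'n" and x :: "int \<Rightarrow> real ^ 'n"
  assumes "\<And>k. x (k + 1) = A *v x k" and "B ** A = mat 1"
  shows "x (k - int m) = matrix_power B m *v x k"
proof (induction m)
  case (Suc m)
  have "x (k - int m) = A *v x (k - int (Suc m))"
    using assms(1)[of "k - int (Suc m)"] by simp
  then have "B *v x (k - int m) = x (k - int (Suc m))"
    by (simp add: matrix_vector_mul_assoc assms(2))
  then show ?case by (simp add: Suc matrix_vector_mul_assoc[symmetric])
qed simp

lemma backward_orbit_past_growth:
  fixes A :: "real ^ 'n ^ 'n" and C :: "real ^ 'n ^ 'm"
  assumes "\<And>k. x (k + 1) = A *v x k" and "anti_stable A" and "1 < s"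
  shows "past_growth s (\<lambda>k. (C *v x k) $ j)"
proof -
  have "invertible A" using anti_stable_invertible assms(2) .
  then have inv: "A ** matrix_inv A = mat 1" "matrix_inv A ** A = mat 1"
    by (simp_all add: matrix_inv_left matrix_inv_right)
  show ?thesis
    unfolding past_growth_def backward_orbit[of x A, OF assms(1) inv(2)]
    using anti_stable_inverse_power_growth[OF assms(2) inv(1) assms(3)] by blast
qed

text \<open>For \<open>y = x k\<close> on an orbit, the powers of the inverse produce past states,
  so the matrix acts as the moving average of the outputs.\<close>

lemma ma_matrix_mult_vector:
  "(C *v (ma_matrix A q g *v y)) $ j =
    (C *v y) $ j + (\<Sum>i=1..q. g i * (C *v (matrix_power (matrix_inv A) i *v y)) $ j)"
proof -
  have "(\<Sum>i\<in>I. g i *\<^sub>R matrix_power (matrix_inv A) i) *v y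
      = (\<Sum>i\<in>I. g i *\<^sub>R (matrix_power (matrix_inv A) i *v y))" for I
    by (induction I rule: infinite_finite_induct)
      (simp_all add: matrix_vector_mult_add_rdistrib scaleR_matrix_vector_assoc)
  moreover have "C *v (\<Sum>i\<in>I. g i *\<^sub>R (matrix_power (matrix_inv A) i *v y))
      = (\<Sum>i\<in>I. g i *\<^sub>R (C *v (matrix_power (matrix_inv A) i *v y)))" for I
    by (induction I rule: infinite_finite_induct)
      (simp_all add: matrix_vector_right_distrib matrix_vector_mult_scaleR)
  ultimately show ?thesis
    by (simp add: ma_matrix_def matrix_vector_mult_add_rdistrib matrix_vector_right_distrib)
qed

lemma ar_matrix_eq_ma_matrix: "ar_matrix A p f = ma_matrix A p (\<lambda>i. - f i)"
  by (simp add: ar_matrix_def ma_matrix_def sum_negf)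

lemma exists_orbit_through:
  fixes A B :: "real ^ 'n ^ 'n"
  assumes "A ** B = mat 1"
  shows "\<exists>x :: int \<Rightarrow> real ^ 'n. x 0 = y \<and> (\<forall>k. x (k + 1) = A *v x k)"
proof -
  define x where "x k = (if 0 \<le> k then matrix_power A (nat k) else matrix_power B (nat (- k))) *v y"
    for k :: int
  have "x (k + 1) = A *v x k" for k
  proof (cases "0 \<le> k")
    case True
    then have "nat (k + 1) = Suc (nat k)" by simp
    with True show ?thesis by (simp add: x_def matrix_vector_mul_assoc)
  next
    case False
    then have "nat (- k) = Suc (nat (- (k + 1)))" by simp
    with False have "A *v x k = matrix_power B (nat (- (k + 1))) *v y"
      by (simp add: x_def matrix_vector_mul_assoc matrix_mul_assoc assms del: nat_minus_as_int)
    \<comment> \<open>At \<open>k = -1\<close> the value \<open>x (k + 1)\<close> lies in the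
      forward branch; both zeroth powers are the identity.\<close>
    also have "\<dots> = x (k + 1)" using False by (cases "k = -1") (auto simp: x_def)
    finally show ?thesis by simp
  qed
  then show ?thesis by (intro exI[of _ x]) (simp add: x_def)
qed

text \<open>A vector in the kernel generates a two-sided orbit which the moving average annihilates, and
  by minimum phase the causal inverse recovers the orbit from the zero sequence.\<close>
lemma ma_matrix_invertible:
  fixes A :: "real ^ 'n ^ 'n"
  assumes "anti_stable A" and "minimum_phase q g"
  shows "invertible (ma_matrix A q g)"
proof -
  have "invertible A" using anti_stable_invertible assms(1) .
  then have inv: "A ** matrix_inv A = mat 1" "matrix_inv A ** A = mat 1"
    by (simp_all add: matrix_inv_left matrix_inv_right)
  obtain r where r: "0 < r" "r < 1" "geom_decay r (inverse (ma_fps q g))"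
    using minimum_phase_geom_decay[OF assms(2)] by blast
  \<comment> \<open>The midpoint of 1 and \<open>1 / r\<close>, so that
    \<open>r * s = (r + 1) / 2 < 1\<close>.\<close>
  define s where "s = (1 + 1 / r) / 2"
  have s: "1 < s" "r * s < 1" using r by (auto simp: s_def field_simps)
  have "y = 0" if y: "ma_matrix A q g *v y = 0" for y
  proof -
    obtain x :: "int \<Rightarrow> real ^ 'n" where x: "x 0 = y" "\<And>k. x (k + 1) = A *v x k"
      using exists_orbit_through[OF inv(1)] by blast
    \<comment> \<open>\<open>z\<close> is the moving average of the orbit \<open>x\<close> and is
      itself an orbit of \<open>A\<close>. It vanishes at time 0, hence at all times.\<close>
    define z where "z k = ma_matrix A q g *v x k" for k
    have z_nth: "(C *v z k) $ j = (C *v x k) $ j + (\<Sum>i=1..q. g i * (C *v x (k - int i)) $ j)"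
      for C :: "real ^ 'n ^ 'n" and k j
      unfolding z_def ma_matrix_mult_vector backward_orbit[of x A, OF x(2) inv(2)] ..
    have step: "z (k + 1) = A *v z k" for k
    proof -
      have "x (k + 1 - int i) = A *v x (k - int i)" for i
        using x(2)[of "k - int i"] by (simp add: algebra_simps)
      then have "z (k + 1) $ j = (A *v z k) $ j" for j
        \<comment> \<open>The output matrices \<open>mat 1\<close> and \<open>A\<close> give the
          coordinates of \<open>z (k + 1)\<close> and of \<open>A *v z k\<close>.\<close>
        using z_nth[of "mat 1" "k + 1" j] z_nth[of A k j] by (simp add: x(2))
      then show ?thesis by (simp add: vec_eq_iff)
    qed
    have "z (int m) = 0" for m
    proof (induction m)
      case (Suc m)
      then show ?case using step[of "int m"] by (simp add: add.commute)
    qed (simp add: z_def x(1) y)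
    moreover have "z (- int m) = 0" for m
      using backward_orbit[of z A, OF step inv(2), of 0 m] by (simp add: z_def x(1) y)
    ultimately have z: "z k = 0" for k
      by (cases k rule: int_cases2) auto
    have "y $ j = 0" for j
    proof -
      have "past_growth s (\<lambda>k. x k $ j)"
        using backward_orbit_past_growth[of x A, OF x(2) assms(1) s(1), of "mat 1" j] by simp
      \<comment> \<open>The orbit solves the recursion with zero input, encoded by the zero sequence
        and an empty moving average of order 0.\<close>
      then have "(\<lambda>n. fps_nth (ma_fps 0 g * inverse (ma_fps q g)) n * 0) sums x 0 $ j"
        using r s z_nth[of "mat 1" _ j]
        by (intro recursion_filter_sums[of r q g s "\<lambda>_. 0" "\<lambda>k. x k $ j"])
          (auto simp: past_growth_def z intro!: exI[of _ 0])
      then show ?thesis using x(1) sums_unique2[OF sums_zero] by simp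
    qed
    then show ?thesis by (simp add: vec_eq_iff)
  qed
  then show ?thesis
    by (auto simp: invertible_left_inverse matrix_left_invertible_ker)
qed

text \<open>\<open>whitened_output_matrix\<close> is chosen so that its product with
  \<open>ma_matrix\<close> is \<open>C ** ar_matrix A p f\<close>. Hence the state parts of
  \<open>y\<close> and \<open>yh\<close> obey the same recursion as the noise parts, and moderate
  growth turns the recursion into filter outputs.\<close>

lemma filtered_plant_pathwise:
  fixes A :: "real ^ 'n ^ 'n" and C :: "real ^ 'n ^ 1" and x :: "int \<Rightarrow> real ^ 'n"
  assumes "anti_stable A" and "invertible (ma_matrix A q g)"
    and x: "\<And>k. x (k + 1) = A *v x k"
    and r: "0 < r" "geom_decay r (inverse (ma_fps q g))" "geom_decay r (inverse (ma_fps p (\<lambda>i. - f i)))"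
    and s: "1 < s" "r * s < 1"
    and u: "past_growth s u"
    and v: "\<And>k. v k = (\<Sum>i=1..p. f i * v (k - int i)) + u k + (\<Sum>j=1..q. g j * u (k - int j))"
    and v_filter: "\<And>k. (\<lambda>m. fps_nth (arma_filter p f q g) m * u (k - int m)) sums v k"
    and y: "\<And>k. y k = (C *v x k) $ 1 + v k"
    and yh: "\<And>k. yh k = (whitened_output_matrix A C p f q g *v x k) $ 1 + u k"
  shows "yh k = - (\<Sum>j=1..q. g j * yh (k - int j)) + y k - (\<Sum>i=1..p. f i * y (k - int i))"
    and "(\<lambda>m. fps_nth (inverse (arma_filter p f q g)) m * y (k - int m)) sums yh k"
    and "(\<lambda>m. fps_nth (arma_filter p f q g) m * yh (k - int m)) sums y k"
proof -
  let ?Chat = "whitened_output_matrix A C p f q g"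
  have "invertible A" using anti_stable_invertible assms(1) .
  then have inv: "matrix_inv A ** A = mat 1" by (simp add: matrix_inv_left)
  have "?Chat ** ma_matrix A q g = C ** ar_matrix A p f"
    by (simp add: whitened_output_matrix_def matrix_mul_assoc[symmetric] matrix_inv_left[OF assms(2)])
  then have "(?Chat *v (ma_matrix A q g *v x k)) $ 1 = (C *v (ma_matrix A p (\<lambda>i. - f i) *v x k)) $ 1" for k
    by (simp add: matrix_vector_mul_assoc ar_matrix_eq_ma_matrix)
  then have outputs: "(?Chat *v x k) $ 1 + (\<Sum>j=1..q. g j * (?Chat *v x (k - int j)) $ 1)
      = (C *v x k) $ 1 + (\<Sum>i=1..p. - f i * (C *v x (k - int i)) $ 1)" for k
    unfolding ma_matrix_mult_vector backward_orbit[of x A, OF x inv] .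
  \<comment> \<open>The state identity \<open>outputs\<close> plus the ARMA recursion of the
    noise.\<close>
  have rec: "yh k + (\<Sum>j=1..q. g j * yh (k - int j)) = y k + (\<Sum>i=1..p. - f i * y (k - int i))" for k
    using outputs[of k] v[of k]
    by (simp add: y yh distrib_left sum.distrib sum_negf sum_subtractf)
  show "yh k = - (\<Sum>j=1..q. g j * yh (k - int j)) + y k - (\<Sum>i=1..p. f i * y (k - int i))"
    using rec[of k] by (simp add: sum_negf)
  have rs: "0 \<le> r" "0 \<le> s" using r(1) s(1) by auto
  have growth: "past_growth s y" "past_growth s yh"
    unfolding y yh
    by (intro past_growth_add backward_orbit_past_growth[of x A, OF x assms(1) s(1)] u
        arma_past_growth[OF r(3,1) rs(2) s(2) u v_filter])+
  show "(\<lambda>m. fps_nth (inverse (arma_filter p f q g)) m * y (k - int m)) sums yh k"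
    unfolding inverse_arma_filter_eq
    by (rule recursion_filter_sums[OF r(2) rs s(2) growth rec])
  \<comment> \<open>The same recursion with \<open>y\<close> and \<open>yh\<close> exchanged; now
    stability supplies the decay.\<close>
  show "(\<lambda>m. fps_nth (arma_filter p f q g) m * yh (k - int m)) sums y k"
    unfolding arma_filter_eq
    by (rule recursion_filter_sums[OF r(3) rs s(2) growth(2,1) rec[symmetric]])
qed

text \<open>Time is countable, so all almost sure equations and the growth bound of the noise hold
  off one null set. Each remaining path is handled by
  \<open>filtered_plant_pathwise\<close>.\<close>

lemma filtered_plant:
  fixes A :: "real ^ 'n ^ 'n" and C :: "real ^ 'n ^ 1" and x :: "int \<Rightarrow> 'a \<Rightarrow> real ^ 'n"
  assumes "prob_space M" and "anti_stable A" and "stable_filter p f" and "minimum_phase q g"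
    and "0 < \<sigma>" and "white_gaussian M \<sigma> u" and "arma_noise M p f q g u v"
    and x: "\<And>k. AE \<omega> in M. x (k + 1) \<omega> = A *v x k \<omega>"
  defines "y \<equiv> \<lambda>k \<omega>. (C *v x k \<omega>) $ 1 + v k \<omega>"
    and "yh \<equiv> \<lambda>k \<omega>. (whitened_output_matrix A C p f q g *v x k \<omega>) $ 1 + u k \<omega>"
  shows "inverse_filtered M p f q g y yh" and "filter_output M (arma_filter p f q g) yh y"
proof -
  interpret prob_space M by fact
  obtain r1 r2 where r12: "0 < r1" "r1 < 1" "geom_decay r1 (inverse (ma_fps q g))"
    "0 < r2" "r2 < 1" "geom_decay r2 (inverse (ma_fps p (\<lambda>i. - f i)))"
    using minimum_phase_geom_decay assms(3,4) unfolding stable_filter_iff_minimum_phase by metis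
  \<comment> \<open>A common rate for the two inverse polynomials; the slower decay bounds
    both.\<close>
  define r where "r = max r1 r2"
  have r: "0 < r" "r < 1" "geom_decay r (inverse (ma_fps q g))"
    "geom_decay r (inverse (ma_fps p (\<lambda>i. - f i)))"
    using r12 by (auto simp: r_def intro: geom_decay_mono)
  define s where "s = (1 + 1 / r) / 2"
  have s: "1 < s" "r * s < 1" using r by (auto simp: s_def field_simps)
  have "u k \<in> borel_measurable M" for k
    using white_gaussian_moments(1)[OF assms(1,5,6)] by (simp add: zero_mean_def borel_measurable_integrable)
  moreover obtain c where "\<And>k. (\<integral>\<^sup>+\<omega>. ennreal \<bar>u k \<omega>\<bar> \<partial>M) \<le> ennreal c"
    using white_gaussian_moments(2)[OF assms(1,5,6)] by metis
  ultimately have "AE \<omega> in M. past_growth s (\<lambda>k. u k \<omega>)"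
    using AE_past_growth[OF _ _ s(1)] by blast
  moreover have "AE \<omega> in M. \<forall>k. x (k + 1) \<omega> = A *v x k \<omega>"
    using x by (simp add: AE_all_countable)
  moreover have "AE \<omega> in M. \<forall>k. v k \<omega> =
      (\<Sum>i=1..p. f i * v (k - int i) \<omega>) + u k \<omega> + (\<Sum>j=1..q. g j * u (k - int j) \<omega>)"
    and "AE \<omega> in M. \<forall>k. (\<lambda>m. fps_nth (arma_filter p f q g) m * u (k - int m) \<omega>) sums v k \<omega>"
    using assms(7) unfolding arma_noise_def filter_output_def AE_all_countable by blast+
  ultimately have "AE \<omega> in M. \<forall>k.
      yh k \<omega> = - (\<Sum>j=1..q. g j * yh (k - int j) \<omega>) + y k \<omega> - (\<Sum>i=1..p. f i * y (k - int i) \<omega>) \<and>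
      (\<lambda>m. fps_nth (inverse (arma_filter p f q g)) m * y (k - int m) \<omega>) sums yh k \<omega> \<and>
      (\<lambda>m. fps_nth (arma_filter p f q g) m * yh (k - int m) \<omega>) sums y k \<omega>"
  proof eventually_elim
    case (elim \<omega>)
    note path = filtered_plant_pathwise[OF assms(2) ma_matrix_invertible[OF assms(2,4)], of "\<lambda>k. x k \<omega>",
        OF elim(2)[rule_format] r(1,3,4) s elim(1) elim(3)[rule_format] elim(4)[rule_format],
        of "\<lambda>k. y k \<omega>" C "\<lambda>k. yh k \<omega>"]
    show ?case by (intro allI conjI path) (simp_all add: y_def yh_def)
  qed
  then show "inverse_filtered M p f q g y yh" "filter_output M (arma_filter p f q g) yh y"
    unfolding inverse_filtered_def filter_output_def AE_all_countable by (auto elim: eventually_mono)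
qed

section \<open>Filter relations up to almost sure equality\<close>

lemma filter_output_cong_AE:
  assumes "filter_output M H u w"
    and "\<And>k. AE \<omega> in M. u k \<omega> = u' k \<omega>" and "\<And>k. AE \<omega> in M. w k \<omega> = w' k \<omega>"
  shows "filter_output M H u' w'"
  unfolding filter_output_def
proof
  fix k
  \<comment> \<open>One output value involves the input at all past times, so a common null set is
    needed.\<close>
  have "AE \<omega> in M. \<forall>k. u k \<omega> = u' k \<omega>" using assms(2) by (simp add: AE_all_countable)
  moreover have "AE \<omega> in M. (\<lambda>m. fps_nth H m * u (k - int m) \<omega>) sums w k \<omega>"
    using assms(1) by (simp add: filter_output_def)
  ultimately show "AE \<omega> in M. (\<lambda>m. fps_nth H m * u' (k - int m) \<omega>) sums w' k \<omega>"
    using assms(3)[of k] by eventually_elim simp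
qed

lemma filter_output_unique_AE:
  assumes "filter_output M H u w" and "filter_output M H u w'"
  shows "AE \<omega> in M. w k \<omega> = w' k \<omega>"
proof -
  have "AE \<omega> in M. (\<lambda>m. fps_nth H m * u (k - int m) \<omega>) sums w k \<omega>"
    "AE \<omega> in M. (\<lambda>m. fps_nth H m * u (k - int m) \<omega>) sums w' k \<omega>"
    using assms by (simp_all add: filter_output_def)
  then show ?thesis by eventually_elim (rule sums_unique2)
qed

lemma inverse_filtered_cong_AE:
  assumes "inverse_filtered M p f q g y yh"
    and y: "\<And>k. AE \<omega> in M. y k \<omega> = y' k \<omega>" and yh: "\<And>k. AE \<omega> in M. yh k \<omega> = yh' k \<omega>"
  shows "inverse_filtered M p f q g y' yh'"
  unfolding inverse_filtered_def
proof (intro conjI allI)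
  fix k
  have "AE \<omega> in M. \<forall>k. y k \<omega> = y' k \<omega>" "AE \<omega> in M. \<forall>k. yh k \<omega> = yh' k \<omega>"
    using y yh by (simp_all add: AE_all_countable)
  moreover have "AE \<omega> in M. yh k \<omega> =
      - (\<Sum>j=1..q. g j * yh (k - int j) \<omega>) + y k \<omega> - (\<Sum>i=1..p. f i * y (k - int i) \<omega>)"
    using assms(1) by (simp add: inverse_filtered_def)
  ultimately show "AE \<omega> in M. yh' k \<omega> =
      - (\<Sum>j=1..q. g j * yh' (k - int j) \<omega>) + y' k \<omega> - (\<Sum>i=1..p. f i * y' (k - int i) \<omega>)"
    by eventually_elim simp
next
  show "filter_output M (inverse (arma_filter p f q g)) y' yh'"
    using filter_output_cong_AE[OF _ y yh] assms(1) by (simp add: inverse_filtered_def)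
qed

theorem proposition1:
  fixes M :: "'a measure"
    and A :: "real ^ 'n ^ 'n" and C Chat :: "real ^ 'n ^ 1"
    and p q :: nat and f g :: "nat \<Rightarrow> real" and \<sigma> :: real
    and x :: "int \<Rightarrow> 'a \<Rightarrow> real ^ 'n" and v vhat :: "int \<Rightarrow> 'a \<Rightarrow> real"
  assumes "prob_space M"
    and "anti_stable A" and "observable A C"
    and "stable_filter p f" and "minimum_phase q g"
    and "0 < \<sigma>" and "white_gaussian M \<sigma> vhat"
    and "zero_mean M x" and "zero_mean M v"
    and "arma_noise M p f q g vhat v"
    and Chat: "Chat = whitened_output_matrix A C p f q g"
  shows "invertible A \<and> invertible (ma_matrix A q g) \<and>
    (\<forall>y. zero_mean M y \<and> plant M A C x v y \<longrightarrow>
       (\<exists>yhat. zero_mean M yhat \<and> inverse_filtered M p f q g y yhat \<and>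
               filter_output M (arma_filter p f q g) yhat y)) \<and>
    (\<forall>yhat. zero_mean M yhat \<and> plant M A Chat x vhat yhat \<longrightarrow>
       (\<exists>y. zero_mean M y \<and> inverse_filtered M p f q g y yhat \<and>
            filter_output M (arma_filter p f q g) yhat y)) \<and>
    (\<forall>y yhat. zero_mean M y \<and> zero_mean M yhat \<and> inverse_filtered M p f q g y yhat \<longrightarrow>
       (plant M A C x v y \<longrightarrow> plant M A Chat x vhat yhat) \<and>
       (filter_output M (arma_filter p f q g) yhat y \<longrightarrow>
          (plant M A C x v y \<longleftrightarrow> plant M A Chat x vhat yhat)))"
proof -
  \<comment> \<open>\<open>y0\<close> and \<open>yh0\<close> are the outputs that the state and the
    noises generate. Given the state equation, being a plant output means being almost surely equal
    to one of them, and they also serve as the existence witnesses.\<close>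
  define y0 where "y0 k \<omega> = (C *v x k \<omega>) $ 1 + v k \<omega>" for k \<omega>
  define yh0 where "yh0 k \<omega> = (Chat *v x k \<omega>) $ 1 + vhat k \<omega>" for k \<omega>
  have zero_mean: "zero_mean M y0" "zero_mean M yh0"
    using zero_mean_output[OF assms(8)] assms(9) white_gaussian_moments(1)[OF assms(1,6,7)]
    by (simp_all add: y0_def[abs_def] yh0_def[abs_def])
  have filtered: "inverse_filtered M p f q g y0 yh0" "filter_output M (arma_filter p f q g) yh0 y0"
    if "\<And>k. AE \<omega> in M. x (k + 1) \<omega> = A *v x k \<omega>"
    using filtered_plant[of M A p f q g \<sigma> vhat v x C, OF assms(1,2,4,5,6,7,10) that]
    by (simp_all add: y0_def[abs_def] yh0_def[abs_def] Chat)
  have plant_y: "plant M A C x v y \<longleftrightarrow> (\<forall>k. AE \<omega> in M. x (k + 1) \<omega> = A *v x k \<omega>) \<and>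
      (\<forall>k. AE \<omega> in M. y k \<omega> = y0 k \<omega>)" for y
    by (simp add: plant_def y0_def)
  have plant_yh: "plant M A Chat x vhat yh \<longleftrightarrow> (\<forall>k. AE \<omega> in M. x (k + 1) \<omega> = A *v x k \<omega>) \<and>
      (\<forall>k. AE \<omega> in M. yh k \<omega> = yh0 k \<omega>)" for yh
    by (simp add: plant_def yh0_def)
  have AE_sym: "\<And>k. AE \<omega> in M. b k \<omega> = a k \<omega>" if "\<forall>k. AE \<omega> in M. a k \<omega> = b k \<omega>"
    for a b :: "int \<Rightarrow> 'a \<Rightarrow> real"
    using that by (simp add: eq_commute)
  show ?thesis
  proof (intro conjI allI impI)
    show "invertible A" using anti_stable_invertible assms(2) .
    show "invertible (ma_matrix A q g)" using ma_matrix_invertible assms(2,5) .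
  next
    fix y assume "zero_mean M y \<and> plant M A C x v y"
    then have x: "\<And>k. AE \<omega> in M. x (k + 1) \<omega> = A *v x k \<omega>" and y: "\<forall>k. AE \<omega> in M. y k \<omega> = y0 k \<omega>"
      by (simp_all add: plant_y)
    show "\<exists>yhat. zero_mean M yhat \<and> inverse_filtered M p f q g y yhat \<and>
        filter_output M (arma_filter p f q g) yhat y"
      using zero_mean inverse_filtered_cong_AE[OF filtered(1)[OF x] AE_sym[OF y]]
        filter_output_cong_AE[OF filtered(2)[OF x] _ AE_sym[OF y]] by (intro exI[of _ yh0]) auto
  next
    fix yh assume "zero_mean M yh \<and> plant M A Chat x vhat yh"
    then have x: "\<And>k. AE \<omega> in M. x (k + 1) \<omega> = A *v x k \<omega>" and yh: "\<forall>k. AE \<omega> in M. yh k \<omega> = yh0 k \<omega>"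
      by (simp_all add: plant_yh)
    show "\<exists>y. zero_mean M y \<and> inverse_filtered M p f q g y yh \<and>
        filter_output M (arma_filter p f q g) yh y"
      using zero_mean inverse_filtered_cong_AE[OF filtered(1)[OF x] _ AE_sym[OF yh]]
        filter_output_cong_AE[OF filtered(2)[OF x] AE_sym[OF yh]] by (intro exI[of _ y0]) auto
  next
    fix y yh
    assume "zero_mean M y \<and> zero_mean M yh \<and> inverse_filtered M p f q g y yh"
    then have out: "filter_output M (inverse (arma_filter p f q g)) y yh"
      by (simp add: inverse_filtered_def)
    \<comment> \<open>\<open>yh\<close> and \<open>yh0\<close> are both outputs of the inverse
      filter driven by \<open>y0\<close>.\<close>
    show fwd: "plant M A Chat x vhat yh" if "plant M A C x v y"
    proof -
      from that have x: "\<And>k. AE \<omega> in M. x (k + 1) \<omega> = A *v x k \<omega>" and y: "\<And>k. AE \<omega> in M. y k \<omega> = y0 k \<omega>"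
        by (simp_all add: plant_y)
      have "filter_output M (inverse (arma_filter p f q g)) y0 yh"
        using out y by (rule filter_output_cong_AE) simp
      moreover have "filter_output M (inverse (arma_filter p f q g)) y0 yh0"
        using filtered(1)[OF x] by (simp add: inverse_filtered_def)
      ultimately show ?thesis using x by (simp add: plant_yh filter_output_unique_AE)
    qed
    assume out': "filter_output M (arma_filter p f q g) yh y"
    \<comment> \<open>Conversely \<open>y\<close> and \<open>y0\<close> are both outputs of the
      filter driven by \<open>yh0\<close>. This uses \<open>out'\<close>, since the inverse filter
      may annihilate a nonzero transient of the autoregressive recursion.\<close>
    have "plant M A C x v y" if "plant M A Chat x vhat yh"
    proof -
      from that have x: "\<And>k. AE \<omega> in M. x (k + 1) \<omega> = A *v x k \<omega>" and yh: "\<And>k. AE \<omega> in M. yh k \<omega> = yh0 k \<omega>"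
        by (simp_all add: plant_yh)
      have "filter_output M (arma_filter p f q g) yh0 y"
        using out' yh by (rule filter_output_cong_AE) simp
      then show ?thesis using x filtered(2)[OF x] by (simp add: plant_y filter_output_unique_AE)
    qed
    with fwd show "plant M A C x v y \<longleftrightarrow> plant M A Chat x vhat yh" by blast
  qed
qed

end
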